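(* Let $R$ be a totally ordered set, let $U=\bigoplus_{j\in J}\mathbb{I}\lceil b'_j,d'_j\rfloor$ and $V=\bigoplus_{i\in I}\mathbb{I}\lceil b_i,d_i\rfloor$ be persistence modules of finite type indexed by $R$ ($I,J$ finite), with $J$ and $I$ given standard orders for the pair $(U,V)$, and let $X$ be a matrix representing a morphism $\varphi\colon U\to V$. Let $P_J$ and $p$ be the pivot data of $X$ defined in the context. Let $XT$ be obtained by ordered column reduction of $X$ and let $$b''_j=\begin{cases}d_{p(j)}&\text{if }j\in P_J\\ b'_j&\text{if }j\in J\setminus P_J.\end{cases}$$ Reorder the columns of $T$ by $b''_j$ and reorder the rows in reverse by $d'_j$. Perform ordered column reduction of $T$ with respect to these orders to obtain $\widetilde T$, and let $q(j)$ be the row index of the pivot of $\widetilde T$ in column $j$. Then $b''_j\le d'_{q(j)}$ for each $j$, $\ker\varphi\cong\bigoplus_{j\in J}\mathbb{I}\lceil b''_j,d'_{q(j)}\rfloor$, and (with respect to such an isomorphism) $\widetilde T$ represents the inclusion $\ker\varphi\hookrightarrow U$.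
   Context: Fix a field $F$; all vector spaces are over $F$. A persistence module indexed by $R$ is a functor from the poset $R$ to vector spaces; morphisms are natural transformations; direct sums, images, kernels, cokernels are pointwise. A cut of $R$ is a pair $c=(c^\downarrow,c^\uparrow)$ of (possibly empty) subsets with $c^\downarrow\cup c^\uparrow=R$ and $r_1<r_2$ for all $r_1\in c^\downarrow$, $r_2\in c^\uparrow$; cuts are ordered by inclusion of $c^\downarrow$. For cuts $b\le d$ (birth and death times), $\lceil b,d\rfloor=b^\uparrow\cap d^\downarrow$. The interval module $\mathbb{I}\lceil b,d\rfloor$ is $F$ at $t\in\lceil b,d\rfloor$ and $0$ elsewhere, with identity structure maps inside the interval and zero maps otherwise. Bars $b=d$ (zero modules) are allowed in decompositions, including that of $\ker\varphi$. Finite type means isomorphic to a finite direct sum of interval modules. Matrix representation: with respect to finite interval decompositions $A\cong\bigoplus_{j\in J}\mathbb{I}\lceil a'_j,c'_j\rfloor$ and $B\cong\bigoplus_{i\in I}\mathbb{I}\lceil a_i,c_i\rfloor$, a matrix $X=\{x_{i,j}\}$ over $F$ represents a morphism $\varphi\colon A\to B$ if $x_{i,j}=0$ whenever $a_i>a'_j$ or $c_i>c'_j$, and for all $i,j$ and all $t\in\lceil a_i,c_i\rfloor\cap\lceil a'_j,c'_j\rfloor$ the composite $\mathbb{I}\lceil a'_j,c'_j\rfloor_t\to A_t\xrightarrow{\varphi_t}B_t\to\mathbb{I}\lceil a_i,c_i\rfloor_t$ is multiplication by $x_{i,j}$. The $i,j$ position is trivial if $c_i\le a'_j$ and nontrivial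 otherwise. Standard orders for $(U,V)$: total orders on $J$ and $I$ with $j<j'$ if $b'_j<b'_{j'}$ and $i<i'$ if $d_i>d_{i'}$ (ties arbitrary). Ordered column reduction of a matrix with ordered rows and columns: process columns from least to greatest. If the current column is zero, move on. Otherwise its first (least-row) nonzero entry is its pivot; add multiples of the current column to each greater column so that the entry in the pivot's row becomes zero; then move on. The result for $X$ is written $XT$, with $T$ (rows and columns indexed by $J$) the product of the corresponding elementary matrices (upper triangular with 1's on the diagonal). Pivot data: using the pivot positions of the reduction of $X$, $P_J\subseteq J$ is the set of $j$ such that column $j$ has a nontrivial pivot (a pivot at $(i,j)$ with $b'_j<d_i$), and for $j\in P_J$, $p(j)\in I$ is the row index of the pivot in column $j$. Reordering of rows and columns is done by changing the orders on the index sets, not by renaming entries: ordering by $b''_j$ means $j<j'$ if $b''_j<b''_{j'}$; ordering in reverse by $d'_j$ means $j<j'$ if $d'_j>d'_{j'}$; ties are arbitrary. Since $T$ is invertible, every column of $\widetilde T$ has a pivot (here "pivot" makes no triviality requirement). *)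

theory Defs
  imports "Jordan_Normal_Form.VS_Connect"
begin

section \<open>Cuts\<close>

typedef (overloaded) ('r::linorder) cut =
  "{(D :: 'r set, E). D \<union> E = UNIV \<and> (\<forall>x\<in>D. \<forall>y\<in>E. x < y)}"
  by (rule exI[of _ "({}, UNIV)"]) simp

definition cut_down :: "'r::linorder cut \<Rightarrow> 'r set" where
  "cut_down c = fst (Rep_cut c)"

definition cut_up :: "'r::linorder cut \<Rightarrow> 'r set" where
  "cut_up c = snd (Rep_cut c)"

lemma cut_less: "x \<in> cut_down c \<Longrightarrow> y \<in> cut_up c \<Longrightarrow> x < y"
  using Rep_cut[of c] by (auto simp: cut_down_def cut_up_def)

lemma cut_up_eq: "cut_up c = - cut_down c"
proof
  show "cut_up c \<subseteq> - cut_down c" using cut_less[of _ c] by fastforce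
  show "- cut_down c \<subseteq> cut_up c"
    using Rep_cut[of c] by (auto simp: cut_down_def cut_up_def)
qed

lemma cut_down_inject: "cut_down c = cut_down d \<longleftrightarrow> c = d"
  by (metis Rep_cut_inject cut_down_def cut_up_def cut_up_eq prod.collapse)

lemma cut_down_total: "cut_down c \<subseteq> cut_down d \<or> cut_down d \<subseteq> cut_down c"
  using cut_less[of _ c] cut_less[of _ d] unfolding cut_up_eq by fastforce

instantiation cut :: (linorder) linorder
begin

definition less_eq_cut :: "'a cut \<Rightarrow> 'a cut \<Rightarrow> bool" where
  "less_eq_cut c d \<longleftrightarrow> cut_down c \<subseteq> cut_down d"

definition less_cut :: "'a cut \<Rightarrow> 'a cut \<Rightarrow> bool" where
  "less_cut c d \<longleftrightarrow> cut_down c \<subset> cut_down d"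

instance
  by standard
    (use cut_down_total in \<open>auto simp: less_eq_cut_def less_cut_def simp flip: cut_down_inject\<close>)

end

definition cut_interval :: "'r::linorder cut \<Rightarrow> 'r cut \<Rightarrow> 'r set" where
  "cut_interval b d = cut_up b \<inter> cut_down d"


section \<open>Persistence modules\<close>

text \<open>
  The base field is the type \<^typ>\<open>'f::field\<close>, seen as a ring record through
  \<^abbrev>\<open>class_ring\<close>; the indexing ordered set is the type \<^typ>\<open>'r::linorder\<close>.  A persistence
  module has a vector space \<open>fib M t\<close> at each index \<open>t\<close> and structure maps
  \<open>str M s t\<close>, which are meaningful for \<open>s \<le> t\<close> only.  The fields \<^const>\<open>monoid.mult\<close>
  and \<^const>\<open>monoid.one\<close> that a module record inherits play no role.
\<close>

record ('r, 'f, 'a) persistence =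
  fib :: "'r \<Rightarrow> ('f, 'a) module"
  str :: "'r \<Rightarrow> 'r \<Rightarrow> 'a \<Rightarrow> 'a"

definition persistence_module :: "('r::linorder, 'f::field, 'a) persistence \<Rightarrow> bool" where
  "persistence_module M \<longleftrightarrow>
     (\<forall>t. vectorspace class_ring (fib M t)) \<and>
     (\<forall>s t. s \<le> t \<longrightarrow> linear_map class_ring (fib M s) (fib M t) (str M s t)) \<and>
     (\<forall>t. \<forall>x\<in>carrier (fib M t). str M t t x = x) \<and>
     (\<forall>r s t. r \<le> s \<longrightarrow> s \<le> t \<longrightarrow>
        (\<forall>x\<in>carrier (fib M r). str M s t (str M r s x) = str M r t x))"

definition pm_morphism ::
  "('r::linorder, 'f::field, 'a) persistence \<Rightarrow> ('r, 'f, 'b) persistence \<Rightarrow> ('r \<Rightarrow> 'a \<Rightarrow> 'b) \<Rightarrow> bool"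
  where
  "pm_morphism A B \<phi> \<longleftrightarrow>
     (\<forall>t. linear_map class_ring (fib A t) (fib B t) (\<phi> t)) \<and>
     (\<forall>s t. s \<le> t \<longrightarrow>
        (\<forall>x\<in>carrier (fib A s). \<phi> t (str A s t x) = str B s t (\<phi> s x)))"

definition pm_iso ::
  "('r::linorder, 'f::field, 'a) persistence \<Rightarrow> ('r, 'f, 'b) persistence \<Rightarrow> ('r \<Rightarrow> 'a \<Rightarrow> 'b) \<Rightarrow> bool"
  where
  "pm_iso A B \<phi> \<longleftrightarrow>
     pm_morphism A B \<phi> \<and> (\<forall>t. bij_betw (\<phi> t) (carrier (fib A t)) (carrier (fib B t)))"

definition pm_kernel ::
  "('r::linorder, 'f::field, 'a) persistence \<Rightarrow> ('r, 'f, 'b) persistence \<Rightarrow> ('r \<Rightarrow> 'a \<Rightarrow> 'b)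
     \<Rightarrow> ('r, 'f, 'a) persistence" where
  "pm_kernel A B \<phi> =
     \<lparr> fib = (\<lambda>t. (fib A t)\<lparr>carrier := {x \<in> carrier (fib A t). \<phi> t x = \<zero>\<^bsub>fib B t\<^esub>}\<rparr>),
       str = str A \<rparr>"

definition pm_direct_sum ::
  "'j set \<Rightarrow> ('j \<Rightarrow> ('r::linorder, 'f::field, 'a) persistence) \<Rightarrow> ('r, 'f, 'j \<Rightarrow> 'a) persistence"
  where
  "pm_direct_sum J M =
     \<lparr> fib = (\<lambda>t.
         \<lparr> carrier = {f \<in> (\<Pi>\<^sub>E j\<in>J. carrier (fib (M j) t)). finite {j\<in>J. f j \<noteq> \<zero>\<^bsub>fib (M j) t\<^esub>}},
           monoid.mult = (\<lambda>f g. \<lambda>j\<in>J. f j \<otimes>\<^bsub>fib (M j) t\<^esub> g j),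
           one = (\<lambda>j\<in>J. \<one>\<^bsub>fib (M j) t\<^esub>),
           ring.zero = (\<lambda>j\<in>J. \<zero>\<^bsub>fib (M j) t\<^esub>),
           add = (\<lambda>f g. \<lambda>j\<in>J. f j \<oplus>\<^bsub>fib (M j) t\<^esub> g j),
           module.smult = (\<lambda>c f. \<lambda>j\<in>J. c \<odot>\<^bsub>fib (M j) t\<^esub> f j) \<rparr>),
       str = (\<lambda>s t f. \<lambda>j\<in>J. str (M j) s t (f j)) \<rparr>"

definition interval_module ::
  "'r::linorder cut \<Rightarrow> 'r cut \<Rightarrow> ('r, 'f::field, 'f) persistence" where
  "interval_module b d =
     \<lparr> fib = (\<lambda>t.
         \<lparr> carrier = (if t \<in> cut_interval b d then UNIV else {0}),
           monoid.mult = (*), one = 1, ring.zero = 0, add = (+), module.smult = (*) \<rparr>),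
       str = (\<lambda>s t x. if s \<in> cut_interval b d \<and> t \<in> cut_interval b d then x else 0) \<rparr>"

definition interval_sum ::
  "'j set \<Rightarrow> ('j \<Rightarrow> 'r::linorder cut) \<Rightarrow> ('j \<Rightarrow> 'r cut) \<Rightarrow> ('r, 'f::field, 'j \<Rightarrow> 'f) persistence"
  where
  "interval_sum J b d = pm_direct_sum J (\<lambda>j. interval_module (b j) (d j))"


section \<open>Matrices representing morphisms\<close>

text \<open>
  A matrix is a function of a row index and a column index; only its values on the index sets at
  hand matter.  Here \<open>\<alpha>\<close> and \<open>\<beta>\<close> are the isomorphisms from the direct sums of intervals
  \<open>\<lceil>a' j, c' j\<rfloor>\<close> (\<open>j \<in> J\<close>) and \<open>\<lceil>a i, c i\<rfloor>\<close> (\<open>i \<in> I\<close>) onto \<open>A\<close> and \<open>B\<close>; columns of \<open>X\<close>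
  are indexed by \<open>J\<close> and rows by \<open>I\<close>.
\<close>

definition represents ::
  "'j set \<Rightarrow> ('j \<Rightarrow> 'r::linorder cut) \<Rightarrow> ('j \<Rightarrow> 'r cut) \<Rightarrow>
   ('r, 'f::field, 'a) persistence \<Rightarrow> ('r \<Rightarrow> ('j \<Rightarrow> 'f) \<Rightarrow> 'a) \<Rightarrow>
   'i set \<Rightarrow> ('i \<Rightarrow> 'r cut) \<Rightarrow> ('i \<Rightarrow> 'r cut) \<Rightarrow>
   ('r, 'f, 'b) persistence \<Rightarrow> ('r \<Rightarrow> ('i \<Rightarrow> 'f) \<Rightarrow> 'b) \<Rightarrow>
   ('i \<Rightarrow> 'j \<Rightarrow> 'f) \<Rightarrow> ('r \<Rightarrow> 'a \<Rightarrow> 'b) \<Rightarrow> bool" where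
  "represents J a' c' A \<alpha> I a c B \<beta> X \<phi> \<longleftrightarrow>
     pm_iso (interval_sum J a' c') A \<alpha> \<and>
     pm_iso (interval_sum I a c) B \<beta> \<and>
     pm_morphism A B \<phi> \<and>
     (\<forall>i\<in>I. \<forall>j\<in>J. a i > a' j \<or> c i > c' j \<longrightarrow> X i j = 0) \<and>
     (\<forall>i\<in>I. \<forall>j\<in>J. \<forall>t \<in> cut_interval (a i) (c i) \<inter> cut_interval (a' j) (c' j). \<forall>x.
        the_inv_into (carrier (fib (interval_sum I a c :: ('r, 'f, 'i \<Rightarrow> 'f) persistence) t)) (\<beta> t)
          (\<phi> t (\<alpha> t (\<lambda>k\<in>J. if k = j then x else 0))) i = X i j * x)"


section \<open>Ordered column reduction\<close>

text \<open>
  A total order on a finite set is given by the list of its elements in increasing order.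
\<close>

definition mat_mult :: "'k set \<Rightarrow> ('i \<Rightarrow> 'k \<Rightarrow> 'f) \<Rightarrow> ('k \<Rightarrow> 'j \<Rightarrow> 'f) \<Rightarrow> 'i \<Rightarrow> 'j \<Rightarrow> 'f::field" where
  "mat_mult K A B = (\<lambda>i j. \<Sum>k\<in>K. A i k * B k j)"

definition identity_matrix :: "'j \<Rightarrow> 'j \<Rightarrow> 'f::field" where
  "identity_matrix = (\<lambda>l m. if l = m then 1 else 0)"

text \<open>Multiplying by this matrix on the right adds \<open>x\<close> times column \<open>j\<close> to column \<open>k\<close>
  (for \<open>j \<noteq> k\<close>).\<close>

definition elementary_matrix :: "'j \<Rightarrow> 'j \<Rightarrow> 'f \<Rightarrow> 'j \<Rightarrow> 'j \<Rightarrow> 'f::field" where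
  "elementary_matrix j k x = (\<lambda>l m. if l = j \<and> m = k then x else identity_matrix l m)"

definition pivot_row :: "'i list \<Rightarrow> ('i \<Rightarrow> 'j \<Rightarrow> 'f::field) \<Rightarrow> 'j \<Rightarrow> 'i option" where
  "pivot_row rs X j = List.find (\<lambda>i. X i j \<noteq> 0) rs"

text \<open>The product of the elementary matrices used when processing column \<open>j\<close>, where \<open>ks\<close>
  lists the greater columns.\<close>

definition clearing_matrix ::
  "'i list \<Rightarrow> 'j set \<Rightarrow> ('i \<Rightarrow> 'j \<Rightarrow> 'f::field) \<Rightarrow> 'j \<Rightarrow> 'j list \<Rightarrow> 'j \<Rightarrow> 'j \<Rightarrow> 'f" where
  "clearing_matrix rs J X j ks =
     (case pivot_row rs X j of
        None \<Rightarrow> identity_matrix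
      | Some i \<Rightarrow>
          foldr (\<lambda>k. mat_mult J (elementary_matrix j k (- (X i k / X i j)))) ks identity_matrix)"

primrec process_columns ::
  "'i list \<Rightarrow> 'j set \<Rightarrow> 'j list \<Rightarrow> ('i \<Rightarrow> 'j \<Rightarrow> 'f::field) \<Rightarrow> 'j \<Rightarrow> 'j \<Rightarrow> 'f" where
  "process_columns rs J [] X = identity_matrix"
| "process_columns rs J (j # ks) X =
     (let E = clearing_matrix rs J X j ks
      in mat_mult J E (process_columns rs J ks (mat_mult J X E)))"

text \<open>The matrix \<open>T\<close>, and the result \<open>XT\<close>, of ordered column reduction of \<open>X\<close>.\<close>

definition reduction_matrix ::
  "'i list \<Rightarrow> 'j list \<Rightarrow> ('i \<Rightarrow> 'j \<Rightarrow> 'f::field) \<Rightarrow> 'j \<Rightarrow> 'j \<Rightarrow> 'f" where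
  "reduction_matrix rs cs X = process_columns rs (set cs) cs X"

definition column_reduction ::
  "'i list \<Rightarrow> 'j list \<Rightarrow> ('i \<Rightarrow> 'j \<Rightarrow> 'f::field) \<Rightarrow> 'i \<Rightarrow> 'j \<Rightarrow> 'f" where
  "column_reduction rs cs X = mat_mult (set cs) X (reduction_matrix rs cs X)"

end

theory Submission
  imports Defs
begin

text \<open>
  Fix an index \<open>t\<close>, write \<open>c \<le> t\<close> for \<open>t \<notin> cut_down c\<close>, and let \<open>K\<close> be the space of vectors \<open>x\<close>
  supported on the columns with \<open>b' \<le> t\<close> such that \<open>X x\<close> vanishes in every row with \<open>d > t\<close>.
  The kernel of \<open>\<phi>\<close> at \<open>t\<close> is the image of \<open>K\<close> under forgetting the coordinates with \<open>d' \<le> t\<close>.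
  As \<open>X T\<close> has distinct pivots and the rows with \<open>d > t\<close> come first, a combination of the columns
  of \<open>T\<close> with \<open>b' \<le> t\<close> lies in \<open>K\<close> iff it uses only columns whose pivot row, if any, has \<open>d \<le> t\<close>;
  so the columns of \<open>T\<close> with \<open>b'' \<le> t\<close> are a basis of \<open>K\<close>.  The second reduction is unitriangular
  for the order by \<open>b''\<close>, so the columns of \<open>T_tilde\<close> with \<open>b'' \<le> t\<close> are again a basis of \<open>K\<close>.
  Those with \<open>d' (q j) \<le> t\<close> are forgotten, and those with \<open>d' (q j) > t\<close> stay independent because
  their pivots are distinct and survive.  The basis of the kernel so obtained is given by the same
  matrix at every \<open>t\<close>, hence it is compatible with the structure maps.
\<close>

section \<open>Ordered column reduction\<close>

lemma sum_two_delta: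
  assumes "finite J" "j \<in> J"
  shows "(\<Sum>m\<in>J. A m * (if m = j then (x::'f::field) else 0)) = A j * x"
  using assms by (simp add: sum.delta' if_distrib cong: if_cong)

lemma sum_eq_single:
  assumes "finite J" "j \<in> J" "\<And>m. m \<in> J \<Longrightarrow> m \<noteq> j \<Longrightarrow> f m = 0"
  shows "sum f J = f j"
  using assms by (simp add: sum.remove[of J j])

lemma sum_mult_nonzero:
  fixes f g :: "'j \<Rightarrow> 'f::field"
  assumes "(\<Sum>k\<in>K. f k * g k) \<noteq> 0"
  shows "\<exists>k\<in>K. f k \<noteq> 0 \<and> g k \<noteq> 0"
proof (rule ccontr)
  assume "\<not> ?thesis"
  then have "f k * g k = 0" if "k \<in> K" for k using that by auto
  then show False using assms by simp
qed

lemma mat_mult_assoc: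
  assumes "finite J"
  shows "mat_mult J (mat_mult J X A) B = mat_mult J X (mat_mult J A B)"
proof (intro ext)
  fix l m
  have "mat_mult J (mat_mult J X A) B l m = (\<Sum>k\<in>J. \<Sum>n\<in>J. X l n * A n k * B k m)"
    by (simp add: mat_mult_def sum_distrib_right)
  also have "\<dots> = (\<Sum>n\<in>J. \<Sum>k\<in>J. X l n * A n k * B k m)"
    by (rule sum.swap)
  also have "\<dots> = mat_mult J X (mat_mult J A B) l m"
    by (simp add: mat_mult_def sum_distrib_left mult.assoc)
  finally show "mat_mult J (mat_mult J X A) B l m = mat_mult J X (mat_mult J A B) l m" .
qed

lemma mat_mult_identity_col:
  assumes "finite J" "m \<in> J" "\<And>k. k \<in> J \<Longrightarrow> A k m = identity_matrix k m"
  shows "mat_mult J X A l m = X l m"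
  using assms by (simp add: mat_mult_def identity_matrix_def sum_two_delta)

section \<open>Entries of the reduction matrix\<close>

lemma clearing_foldr:
  assumes "finite J" "distinct ks" "j \<notin> set ks" "set ks \<subseteq> J" "l \<in> J" "m \<in> J"
  shows "foldr (\<lambda>k. mat_mult J (elementary_matrix j k (x k))) ks identity_matrix l m
    = (if l = j \<and> m \<in> set ks then x m else identity_matrix l m)"
  using assms
proof (induction ks arbitrary: l m)
  case Nil
  then show ?case by (simp)
next
  case (Cons k ks)
  let ?M = "foldr (\<lambda>k. mat_mult J (elementary_matrix j k (x k))) ks identity_matrix"
  have "foldr (\<lambda>k. mat_mult J (elementary_matrix j k (x k))) (k # ks) identity_matrix l m
     = (\<Sum>n\<in>J. elementary_matrix j k (x k) l n * ?M n m)" by (simp add: mat_mult_def)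
  \<comment> \<open>The left factor adds \<open>x k\<close> times row \<open>k\<close> of
    \<open>?M\<close> to row \<open>j\<close>. Since \<open>k\<close> differs from \<open>j\<close>,
    row \<open>k\<close> of \<open>?M\<close> is still an identity row, so the factors do not
    interact.\<close>
  also have "\<dots> = (\<Sum>n\<in>J. (if n = l then ?M n m else 0) + (if n = k then (if l = j then x k * ?M n m else 0) else 0))"
    using Cons.prems by (intro sum.cong) (auto simp: elementary_matrix_def identity_matrix_def)
  also have "\<dots> = ?M l m + (if l = j then x k * ?M k m else 0)"
    using Cons.prems by (subst sum.distrib) (simp add: sum.delta)
  also have "\<dots> = (if l = j \<and> m \<in> set (k # ks) then x m else identity_matrix l m)"
    using Cons.prems Cons.IH[of l m] Cons.IH[of k m] by (auto simp: identity_matrix_def)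
  finally show ?case .
qed

lemma pivot_row_SomeD:
  assumes "pivot_row rs X j = Some i"
  shows "i \<in> set rs" "X i j \<noteq> 0"
  using assms by (auto simp: pivot_row_def find_Some_iff)

lemma clearing_matrix_eq:
  assumes "finite J" "distinct ks" "j \<notin> set ks" "set ks \<subseteq> J" "l \<in> J" "m \<in> J"
  shows "clearing_matrix rs J X j ks l m =
    (case pivot_row rs X j of None \<Rightarrow> identity_matrix l m
      | Some i \<Rightarrow> if l = j \<and> m \<in> set ks then - (X i m / X i j) else identity_matrix l m)"
  using assms clearing_foldr[of J ks j l m "\<lambda>k. - (X i k / X i j)" for i]
  by (auto simp: clearing_matrix_def split: option.split)

text \<open>Columns are only added to later ones. A nonzero entry of the product passes through some
  \<open>k\<close>: the clearing step is off-diagonal in row \<open>j\<close> only, and the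
  remaining steps stay inside \<open>ks\<close>. The relation \<open>r\<close> is a parameter so
  that list positions as well as comparisons of births can be inserted for it.\<close>

lemma process_columns_unitriangular:
  assumes "finite J" "distinct ks" "set ks \<subseteq> J" "sorted_wrt r ks" "l \<in> J" "m \<in> J"
    "l \<noteq> m" "process_columns rs J ks X l m \<noteq> 0"
  shows "l \<in> set ks \<and> m \<in> set ks \<and> r l m"
  using assms
proof (induction ks arbitrary: X l m)
  case Nil
  then show ?case by (simp add: identity_matrix_def)
next
  case (Cons j ks)
  let ?E = "clearing_matrix rs J X j ks"
  let ?M = "process_columns rs J ks (mat_mult J X ?E)"
  have "(\<Sum>k\<in>J. ?E l k * ?M k m) \<noteq> 0"
    using Cons.prems by (simp add: Let_def mat_mult_def)
  then obtain k where k: "k \<in> J" "?E l k * ?M k m \<noteq> 0"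
    by (meson sum.neutral)
  have E: "l = k \<or> l = j \<and> k \<in> set ks"
    using k Cons.prems clearing_matrix_eq[of J ks j l k rs X]
    by (auto simp: identity_matrix_def split: option.splits if_splits)
  have M: "k = m \<or> k \<in> set ks \<and> m \<in> set ks \<and> r k m"
    using Cons.IH[of k m "mat_mult J X ?E"] k Cons.prems by auto
  show ?case using E M Cons.prems by auto
qed

text \<open>Only \<open>k = m\<close> contributes to the diagonal sum: an off-diagonal entry of the
  clearing step lies in row \<open>j\<close>, and column \<open>j\<close> of the later product is
  off-diagonally zero.\<close>

lemma process_columns_diag:
  assumes "finite J" "distinct ks" "set ks \<subseteq> J" "m \<in> J"
  shows "process_columns rs J ks X m m = 1"
  using assms
proof (induction ks arbitrary: X m)
  case Nil
  then show ?case by (simp add: identity_matrix_def)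
next
  case (Cons j ks)
  let ?E = "clearing_matrix rs J X j ks"
  let ?M = "process_columns rs J ks (mat_mult J X ?E)"
  have "process_columns rs J (j # ks) X m m = (\<Sum>k\<in>J. ?E m k * ?M k m)"
    by (simp add: Let_def mat_mult_def)
  also have "\<dots> = (\<Sum>k\<in>J. if k = m then 1 else 0)"
  proof (intro sum.cong refl)
    fix k assume "k \<in> J"
    have *: "k \<noteq> m \<Longrightarrow> ?M k m \<noteq> 0 \<Longrightarrow> k \<in> set ks \<and> m \<in> set ks"
      using process_columns_unitriangular[of J ks "\<lambda>_ _. True" k m] \<open>k \<in> J\<close> Cons.prems
      by (auto simp: sorted_wrt_iff_nth_less)
    show "?E m k * ?M k m = (if k = m then 1 else 0)"
      using * \<open>k \<in> J\<close> Cons.prems Cons.IH[of m] clearing_matrix_eq[of J ks j m k rs X]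
      by (auto simp: identity_matrix_def split: option.splits)
  qed
  finally show ?case using Cons.prems by (simp add: sum.delta)
qed

section \<open>Distinct pivots and the coefficients they force to vanish\<close>

definition reduced :: "'i list \<Rightarrow> 'j set \<Rightarrow> ('i \<Rightarrow> 'j \<Rightarrow> 'f::field) \<Rightarrow> bool" where
  "reduced rs J R \<longleftrightarrow> (\<forall>j\<in>J. \<forall>k\<in>J. j \<noteq> k \<longrightarrow>
     pivot_row rs R j \<noteq> None \<longrightarrow> pivot_row rs R j \<noteq> pivot_row rs R k)"

lemma pivot_row_cong: "(\<And>i. i \<in> set rs \<Longrightarrow> X i j = Y i j) \<Longrightarrow> pivot_row rs X j = pivot_row rs Y j"
  by (induction rs) (auto simp: pivot_row_def)

text \<open>Column \<open>j\<close> is final once it is reached, so it keeps its pivot. Clearing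
  makes the later columns zero in that row, and later steps combine only these columns, so the row
  stays zero there.\<close>

lemma process_columns_reduced:
  assumes "finite J" "distinct ks" "set ks \<subseteq> J"
  shows "reduced rs (set ks) (mat_mult J X (process_columns rs J ks X))"
  using assms
proof (induction ks arbitrary: X)
  case Nil
  then show ?case by (simp add: reduced_def)
next
  case (Cons j ks)
  let ?E = "clearing_matrix rs J X j ks"
  let ?X = "mat_mult J X ?E"
  let ?M = "process_columns rs J ks ?X"
  let ?R = "mat_mult J ?X ?M"
  have R: "mat_mult J X (process_columns rs J (j # ks) X) = ?R"
    using Cons.prems by (simp add: Let_def mat_mult_assoc)
  have M: "k = m \<or> k \<in> set ks \<and> m \<in> set ks"
    if "k \<in> J" "m \<in> J" "?M k m \<noteq> 0" for k m
    using process_columns_unitriangular[of J ks "\<lambda>_ _. True" k m] that Cons.prems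
    by (auto simp: sorted_wrt_iff_nth_less)
  have col_j: "?R i j = X i j" for i
  proof -
    have "?M k j = identity_matrix k j" if "k \<in> J" for k
      using M[of k j] process_columns_diag[of J ks j rs ?X] that Cons.prems
      by (auto simp: identity_matrix_def)
    then have "?R i j = ?X i j"
      using Cons.prems by (intro mat_mult_identity_col) auto
    also have "\<dots> = X i j"
      using Cons.prems clearing_matrix_eq[of J ks j _ j rs X]
      by (intro mat_mult_identity_col) (auto split: option.splits)
    finally show ?thesis .
  qed
  have pivot_j: "pivot_row rs ?R j = pivot_row rs X j"
    using col_j by (rule pivot_row_cong)
  have cleared: "?R i k = 0" if piv: "pivot_row rs X j = Some i" and k: "k \<in> set ks" for i k
  proof -
    have X0: "?X i n = 0" if n: "n \<in> set ks" for n
    proof -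
      have "?X i n = (\<Sum>l\<in>J. X i l * (if l = n then 1 else 0) + X i l * (if l = j then - (X i n / X i j) else 0))"
        unfolding mat_mult_def using n Cons.prems piv clearing_matrix_eq[of J ks j _ n rs X]
        by (intro sum.cong refl) (auto simp: identity_matrix_def)
      also have "\<dots> = X i n * 1 + X i j * (- (X i n / X i j))"
        using n Cons.prems by (subst sum.distrib, subst (1 2) sum_two_delta) auto
      finally show ?thesis using pivot_row_SomeD[OF piv] by simp
    qed
    have "?X i l * ?M l k = 0" if "l \<in> J" for l
      using M[of l k] X0[of l] that k Cons.prems by auto
    then show ?thesis by (simp add: mat_mult_def[of J ?X])
  qed
  have jk: "pivot_row rs ?R j \<noteq> pivot_row rs ?R k" if "pivot_row rs ?R j \<noteq> None" "k \<in> set ks" for k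
    using that cleared pivot_j pivot_row_SomeD(2)[of rs ?R k] by force
  have kj: "pivot_row rs ?R k \<noteq> pivot_row rs ?R j" if "pivot_row rs ?R k \<noteq> None" "k \<in> set ks" for k
    using that jk[of k] by force
  have "reduced rs (set ks) ?R" using Cons by auto
  then show ?case unfolding R using jk kj by (auto simp: reduced_def)
qed

lemma pivot_row_append:
  assumes "X i j \<noteq> 0"
  shows "\<exists>k. pivot_row (us @ i # vs) X j = Some k \<and> (k \<in> set us \<or> k = i)"
  using assms by (induction us) (auto simp: pivot_row_def)

text \<open>Go through the rows from the top. In the last row of \<open>us\<close>, any column other
  than \<open>j\<close> with a nonzero entry has its pivot strictly higher, as pivots are distinct,
  and so has coefficient 0 by induction. Only the term of column \<open>j\<close> is left.\<close>

lemma reduced_independent: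
  assumes "reduced rs J R" "finite J" "rs = us @ vs"
    "\<And>i. i \<in> set us \<Longrightarrow> (\<Sum>j\<in>J. R i j * y j) = 0"
    "j \<in> J" "pivot_row rs R j = Some i" "i \<in> set us"
  shows "y j = 0"
  using assms(3-)
proof (induction us arbitrary: vs j i rule: rev_induct)
  case Nil
  then show ?case by simp
next
  case (snoc i' us)
  show ?case
  proof (cases "i \<in> set us")
    case True
    then show ?thesis using snoc.IH[of "i' # vs" j i] snoc.prems by simp
  next
    case False
    then have i: "i = i'" using snoc.prems by auto
    have "R i m * y m = 0" if "m \<in> J" "m \<noteq> j" for m
    proof (rule ccontr)
      assume *: "R i m * y m \<noteq> 0"
      then obtain i'' where piv: "pivot_row rs R m = Some i''" "i'' \<in> set us \<or> i'' = i"
        using snoc.prems(1) i pivot_row_append[of R i m us vs] by auto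
      then have "i'' \<in> set us"
        using assms(1) snoc.prems(3,4) that by (metis option.distinct(1) reduced_def)
      then show False using snoc.IH[of "i' # vs" m i''] snoc.prems piv that * by simp
    qed
    then have "(\<Sum>m\<in>J. R i m * y m) = R i j * y j"
      using snoc.prems(3) assms(2) by (intro sum_eq_single) auto
    then show ?thesis using snoc.prems(2)[of i] i pivot_row_SomeD(2)[OF snoc.prems(4)] by simp
  qed
qed

lemma sorted_wrt_split:
  assumes "sorted_wrt (\<lambda>a b. Q b \<longrightarrow> Q a) rs"
  shows "\<exists>us vs. rs = us @ vs \<and> set us = {i \<in> set rs. Q i}"
  using assms
proof (induction rs)
  case (Cons a rs)
  then obtain us vs where *: "rs = us @ vs" "set us = {i \<in> set rs. Q i}" by auto
  show ?case
  proof (cases "Q a")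
    case True
    with * show ?thesis by (intro exI[of _ "a # us"] exI[of _ vs]) auto
  next
    case False
    with Cons.prems show ?thesis by (intro exI[of _ "[] :: 'a list"] exI[of _ "a # rs"]) auto
  qed
qed simp

text \<open>Sortedness makes the rows with \<open>Q\<close> an initial segment. Later
  \<open>Q\<close> says that the death time of the row exceeds a fixed \<open>t\<close>, or is
  always true.\<close>

lemma reduced_coefficient_zero:
  assumes "reduced rs J R" "finite J" "sorted_wrt (\<lambda>a b. Q b \<longrightarrow> Q a) rs"
    "\<And>i. i \<in> set rs \<Longrightarrow> Q i \<Longrightarrow> (\<Sum>j\<in>J. R i j * y j) = 0"
    "j \<in> J" "pivot_row rs R j = Some i" "Q i"
  shows "y j = 0"
proof -
  obtain us vs where "rs = us @ vs" "set us = {i \<in> set rs. Q i}"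
    using sorted_wrt_split[OF assms(3)] by auto
  then show ?thesis
    using reduced_independent[of rs J R us vs y j i] assms pivot_row_SomeD(1)[OF assms(6)] by auto
qed

section \<open>Unitriangular systems of equations\<close>

definition unitriangular :: "'j list \<Rightarrow> ('j \<Rightarrow> 'j \<Rightarrow> 'f::field) \<Rightarrow> bool" where
  "unitriangular cs M \<longleftrightarrow> distinct cs \<and> (\<forall>j\<in>set cs. M j j = 1) \<and> sorted_wrt (\<lambda>l m. M m l = 0) cs"

lemma unitriangular_reduction_matrix:
  assumes "distinct cs"
  shows "unitriangular cs (reduction_matrix rs cs X)"
proof -
  let ?M = "reduction_matrix rs cs X"
  \<comment> \<open>Taking strict list position for \<open>r\<close> turns the general bound on
    nonzero entries into triangularity: an entry below the diagonal would reverse two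
    positions.\<close>
  let ?r = "\<lambda>l m. \<exists>k n. k < n \<and> n < length cs \<and> l = cs ! k \<and> m = cs ! n"
  have r: "sorted_wrt ?r cs"
    by (auto simp: sorted_wrt_iff_nth_less)
  have "sorted_wrt (\<lambda>l m. ?M m l = 0) cs"
    unfolding sorted_wrt_iff_nth_less
  proof (intro allI impI)
    fix k n assume kn: "k < n" "n < length cs"
    show "?M (cs ! n) (cs ! k) = 0"
    proof (rule ccontr)
      assume "?M (cs ! n) (cs ! k) \<noteq> 0"
      then have "?r (cs ! n) (cs ! k)"
        using process_columns_unitriangular[of "set cs" cs ?r "cs ! n" "cs ! k" rs X] r kn assms
        by (auto simp: reduction_matrix_def nth_eq_iff_index_eq)
      then show False using kn assms by (auto simp: nth_eq_iff_index_eq)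
    qed
  qed
  then show ?thesis
    using assms process_columns_diag[of "set cs" cs] by (auto simp: unitriangular_def reduction_matrix_def)
qed

text \<open>Back substitution: in row \<open>j\<close> the earlier columns have entry 0 and the
  later coefficients are already known to be 0.\<close>

lemma unitriangular_injective:
  assumes "unitriangular cs M" "\<And>l. l \<in> set cs \<Longrightarrow> (\<Sum>m\<in>set cs. M l m * y m) = 0" "j \<in> set cs"
  shows "y j = 0"
proof -
  have "\<forall>j\<in>set vs. y j = 0" if "cs = us @ vs" for us vs
    using that
  proof (induction vs arbitrary: us)
    case (Cons j vs)
    then have vs: "\<forall>k\<in>set vs. y k = 0" by simp
    have "M j m * y m = 0" if "m \<in> set cs" "m \<noteq> j" for m
      using vs that Cons.prems assms(1) by (auto simp: unitriangular_def sorted_wrt_append)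
    then have "(\<Sum>m\<in>set cs. M j m * y m) = M j j * y j"
      using Cons.prems by (intro sum_eq_single) auto
    moreover have "M j j = 1" "j \<in> set cs" using Cons.prems assms(1) by (auto simp: unitriangular_def)
    ultimately show ?case using vs assms(2)[of j] by simp
  qed simp
  then show ?thesis using assms(3) by auto
qed

text \<open>Back substitution that keeps track of supports. Subtracting \<open>x j\<close> times
  column \<open>j\<close> clears the last possibly nonzero coordinate, and \<open>closed\<close>
  keeps the remainder supported on \<open>Q\<close>. Hence the columns in \<open>Q\<close> span all
  vectors supported on \<open>Q\<close>.\<close>

lemma unitriangular_solve:
  assumes "unitriangular cs M"
    and closed: "\<And>l m. l \<in> set cs \<Longrightarrow> m \<in> set cs \<Longrightarrow> M l m \<noteq> 0 \<Longrightarrow> Q m \<Longrightarrow> Q l"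
    and supp: "\<And>l. l \<in> set cs \<Longrightarrow> x l \<noteq> 0 \<Longrightarrow> Q l"
  shows "\<exists>y. (\<forall>l\<in>set cs. y l \<noteq> 0 \<longrightarrow> Q l) \<and> (\<forall>l\<in>set cs. x l = (\<Sum>m\<in>set cs. M l m * y m))"
proof -
  have "\<exists>y. (\<forall>l\<in>set cs. y l \<noteq> 0 \<longrightarrow> Q l) \<and> (\<forall>l\<in>set cs. x l = (\<Sum>m\<in>set cs. M l m * y m))"
    if "cs = us @ vs" "\<And>l. l \<in> set cs \<Longrightarrow> x l \<noteq> 0 \<Longrightarrow> Q l" "\<And>l. l \<in> set vs \<Longrightarrow> x l = 0" for us vs x
    using that
  proof (induction us arbitrary: vs x rule: rev_induct)
    case Nil
    then show ?case by (intro exI[of _ "\<lambda>_. 0"]) auto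
  next
    case (snoc j us)
    define x' where "x' = (\<lambda>l. x l - M l j * x j)"
    have j: "j \<in> set cs" "M j j = 1" using snoc.prems assms(1) by (auto simp: unitriangular_def)
    have "x' l = 0" if "l \<in> set (j # vs)" for l
      using that snoc.prems assms(1) by (auto simp: x'_def unitriangular_def sorted_wrt_append)
    moreover have "Q l" if "l \<in> set cs" "x' l \<noteq> 0" for l
    proof (cases "x l = 0")
      case True
      then show ?thesis using that closed[of l j] snoc.prems(2)[of j] j by (auto simp: x'_def)
    next
      case False
      then show ?thesis using that snoc.prems(2) by auto
    qed
    ultimately obtain y where y: "\<forall>l\<in>set cs. y l \<noteq> 0 \<longrightarrow> Q l"
        "\<forall>l\<in>set cs. x' l = (\<Sum>m\<in>set cs. M l m * y m)"
      using snoc.IH[of "j # vs" x'] snoc.prems(1) by auto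
    let ?y = "\<lambda>m. y m + (if m = j then x j else 0)"
    have "x l = (\<Sum>m\<in>set cs. M l m * ?y m)" if "l \<in> set cs" for l
    proof -
      have "(\<Sum>m\<in>set cs. M l m * ?y m) = (\<Sum>m\<in>set cs. M l m * y m) + M l j * x j"
        unfolding distrib_left sum.distrib using j by (simp add: sum_two_delta)
      also have "\<dots> = x' l + M l j * x j" using y(2) that by simp
      also have "\<dots> = x l" by (simp add: x'_def)
      finally show ?thesis by simp
    qed
    then show ?case using y(1) snoc.prems(2) j by (intro exI[of _ ?y]) (auto split: if_splits)
  qed
  from this[of cs "[]" x] show ?thesis using supp by auto
qed

text \<open>Columns are added to later ones only, and \<open>f\<close> does not decrease along
  \<open>cs\<close>. It will be applied with \<open>b'\<close> to the first reduction and with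
  \<open>b''\<close> to the second.\<close>

lemma reduction_matrix_mono:
  assumes "distinct cs" "sorted (map f cs)" "l \<in> set cs" "m \<in> set cs" "reduction_matrix rs cs X l m \<noteq> 0"
  shows "f l \<le> f m"
  using process_columns_unitriangular[of "set cs" cs "\<lambda>l m. f l \<le> f m" l m rs X] assms
  by (cases "l = m") (auto simp: reduction_matrix_def sorted_map)

lemma reduced_column_reduction: "distinct cs \<Longrightarrow> reduced rs (set cs) (column_reduction rs cs X)"
  by (simp add: column_reduction_def reduction_matrix_def process_columns_reduced)

text \<open>The pivot is the first nonzero row, and \<open>d\<close> decreases weakly along
  \<open>rs\<close>.\<close>

lemma pivot_row_maximal:
  fixes d :: "'i \<Rightarrow> 'o::linorder"
  assumes "pivot_row rs X j = Some i" "sorted_wrt (\<ge>) (map d rs)" "l \<in> set rs" "X l j \<noteq> 0"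
  shows "d l \<le> d i"
  using assms by (induction rs) (auto simp: pivot_row_def split: if_splits)

lemma pivot_row_None_iff: "pivot_row rs X j = None \<longleftrightarrow> (\<forall>i\<in>set rs. X i j = 0)"
  by (auto simp: pivot_row_def find_None_iff)

lemma mat_mult_vec:
  "(\<Sum>j\<in>J. mat_mult K A B l j * y j) = (\<Sum>k\<in>K. A l k * (\<Sum>j\<in>J. B k j * y j))"
proof -
  have "(\<Sum>j\<in>J. mat_mult K A B l j * y j) = (\<Sum>j\<in>J. \<Sum>k\<in>K. A l k * B k j * y j)"
    by (simp add: mat_mult_def sum_distrib_right)
  also have "\<dots> = (\<Sum>k\<in>K. \<Sum>j\<in>J. A l k * B k j * y j)" by (rule sum.swap)
  finally show ?thesis by (simp add: sum_distrib_left mult.assoc)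
qed


section \<open>Persistence modules in coordinates\<close>

lemma cut_interval_iff: "t \<in> cut_interval b d \<longleftrightarrow> t \<notin> cut_down b \<and> t \<in> cut_down d"
  by (simp add: cut_interval_def cut_up_eq)

lemma cut_down_closed: "t \<in> cut_down c \<Longrightarrow> s \<le> t \<Longrightarrow> s \<in> cut_down c"
  by (metis ComplI cut_less cut_up_eq not_le)

lemma linear_map_iff:
  "linear_map class_ring V W T \<longleftrightarrow>
     vectorspace class_ring V \<and> vectorspace class_ring W \<and> (\<forall>x\<in>carrier V. T x \<in> carrier W) \<and>
     (\<forall>x\<in>carrier V. \<forall>y\<in>carrier V. T (x \<oplus>\<^bsub>V\<^esub> y) = T x \<oplus>\<^bsub>W\<^esub> T y) \<and>
     (\<forall>c. \<forall>x\<in>carrier V. T (c \<odot>\<^bsub>V\<^esub> x) = c \<odot>\<^bsub>W\<^esub> T x)"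
  by (auto simp: linear_map_def mod_hom_def mod_hom_axioms_def LinearCombinations.module_hom_def
      vectorspace_def)

lemma linear_map_zero:
  assumes "linear_map class_ring V W T"
  shows "T \<zero>\<^bsub>V\<^esub> = \<zero>\<^bsub>W\<^esub>"
  using assms mod_hom.f0_is_0 unfolding linear_map_def by blast

lemma linear_map_compose:
  assumes "linear_map class_ring V W S" "linear_map class_ring W Z T"
  shows "linear_map class_ring V Z (\<lambda>x. T (S x))"
  using assms by (auto simp: linear_map_iff)

lemma interval_sum_simps:
  fixes J :: "'j set" and b d :: "'j \<Rightarrow> 'r::linorder cut" and t :: 'r
  defines "W \<equiv> fib (interval_sum J b d :: ('r, 'f::field, 'j \<Rightarrow> 'f) persistence) t"
  shows "\<zero>\<^bsub>W\<^esub> = (\<lambda>j\<in>J. 0)"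
    and "f \<oplus>\<^bsub>W\<^esub> g = (\<lambda>j\<in>J. f j + g j)"
    and "c \<odot>\<^bsub>W\<^esub> f = (\<lambda>j\<in>J. c * f j)"
  by (simp_all add: W_def interval_sum_def pm_direct_sum_def interval_module_def)

lemma interval_sum_carrier:
  fixes b d :: "'j \<Rightarrow> 'r::linorder cut" and t :: 'r and f :: "'j \<Rightarrow> 'f::field"
  assumes "finite J"
  shows "f \<in> carrier (fib (interval_sum J b d) t) \<longleftrightarrow>
    f \<in> extensional J \<and> (\<forall>j\<in>J. t \<notin> cut_interval (b j) (d j) \<longrightarrow> f j = 0)"
  using assms
  by (auto simp: interval_sum_def pm_direct_sum_def interval_module_def PiE_def Pi_iff)

lemma interval_sum_str:
  fixes b d :: "'j \<Rightarrow> 'r::linorder cut" and s t :: 'r and f :: "'j \<Rightarrow> 'f::field"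
  shows "str (interval_sum J b d) s t f =
    (\<lambda>j\<in>J. if s \<in> cut_interval (b j) (d j) \<and> t \<in> cut_interval (b j) (d j) then f j else 0)"
  by (simp add: interval_sum_def pm_direct_sum_def interval_module_def cong: restrict_cong)

lemma vectorspace_interval_sum:
  fixes b d :: "'j \<Rightarrow> 'r::linorder cut" and t :: 'r
  assumes "finite J"
  shows "vectorspace class_ring (fib (interval_sum J b d :: ('r, 'f::field, 'j \<Rightarrow> 'f) persistence) t)"
    (is "vectorspace _ ?W")
proof -
  have "abelian_group ?W"
  proof (rule abelian_groupI)
    fix f assume "f \<in> carrier ?W"
    then show "\<exists>g\<in>carrier ?W. g \<oplus>\<^bsub>?W\<^esub> f = \<zero>\<^bsub>?W\<^esub>"
      using assms by (intro bexI[of _ "\<lambda>j\<in>J. - f j"]) (auto simp: interval_sum_carrier interval_sum_simps)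
  qed (use assms in \<open>auto simp: interval_sum_carrier interval_sum_simps fun_eq_iff
        extensional_def algebra_simps\<close>)
  then have "module class_ring ?W"
    using assms by (intro Module.module.intro class_cring.is_cring Module.module_axioms.intro)
      (auto simp: interval_sum_carrier interval_sum_simps fun_eq_iff extensional_def algebra_simps)
  then show ?thesis by (simp add: vectorspace_def class_field)
qed

section \<open>Coordinates of a morphism between interval sums\<close>

lemma pm_iso_inverse:
  fixes \<beta> :: "'r::linorder \<Rightarrow> 'b \<Rightarrow> 'c"
  assumes "pm_iso A B \<beta>" "y \<in> carrier (fib B t)"
  shows "the_inv_into (carrier (fib A t)) (\<beta> t) y \<in> carrier (fib A t)"
    and "\<beta> t (the_inv_into (carrier (fib A t)) (\<beta> t) y) = y"
  using assms unfolding pm_iso_def bij_betw_def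
  by (metis the_inv_into_into order_refl, metis f_the_inv_into_f)

lemma pm_iso_inverse_add:
  assumes "pm_iso A B \<beta>" "y \<in> carrier (fib B t)" "z \<in> carrier (fib B t)"
  shows "the_inv_into (carrier (fib A t)) (\<beta> t) (y \<oplus>\<^bsub>fib B t\<^esub> z) =
    the_inv_into (carrier (fib A t)) (\<beta> t) y \<oplus>\<^bsub>fib A t\<^esub> the_inv_into (carrier (fib A t)) (\<beta> t) z"
proof -
  let ?g = "the_inv_into (carrier (fib A t)) (\<beta> t)"
  have lin: "linear_map class_ring (fib A t) (fib B t) (\<beta> t)" and inj: "inj_on (\<beta> t) (carrier (fib A t))"
    using assms(1) by (auto simp: pm_iso_def pm_morphism_def bij_betw_def)
  interpret A: vectorspace class_ring "fib A t" using lin by (simp add: linear_map_iff)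
  have "\<beta> t (?g y \<oplus>\<^bsub>fib A t\<^esub> ?g z) = y \<oplus>\<^bsub>fib B t\<^esub> z"
    using lin pm_iso_inverse[OF assms(1,2)] pm_iso_inverse[OF assms(1,3)] by (simp add: linear_map_iff)
  moreover have "?g y \<oplus>\<^bsub>fib A t\<^esub> ?g z \<in> carrier (fib A t)"
    using pm_iso_inverse(1)[OF assms(1,2)] pm_iso_inverse(1)[OF assms(1,3)] by simp
  ultimately show ?thesis using the_inv_into_f_f[OF inj] by metis
qed

text \<open>\<open>represents\<close> speaks of vectors with a single nonzero coordinate at a bar
  containing \<open>t\<close>. Additivity extends this to \<open>x\<close>, adding one coordinate at
  a time; at a bar that misses \<open>t\<close> the coordinate of \<open>x\<close> is 0
  anyway.\<close>

lemma represents_coordinates: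
  fixes \<beta> :: "'r::linorder \<Rightarrow> ('i \<Rightarrow> 'f::field) \<Rightarrow> 'b" and x :: "'j \<Rightarrow> 'f"
  assumes "finite J" "finite I"
    and rep: "represents J a' c' A \<alpha> I a c B \<beta> X \<phi>"
    and x: "x \<in> carrier (fib (interval_sum J a' c') t)"
    and i: "i \<in> I" "t \<in> cut_interval (a i) (c i)"
  shows "the_inv_into (carrier (fib (interval_sum I a c :: ('r, 'f, 'i \<Rightarrow> 'f) persistence) t)) (\<beta> t)
           (\<phi> t (\<alpha> t x)) i = (\<Sum>j\<in>J. X i j * x j)"
proof -
  let ?W = "fib (interval_sum J a' c' :: ('r, 'f, 'j \<Rightarrow> 'f) persistence) t"
  let ?g = "the_inv_into (carrier (fib (interval_sum I a c :: ('r, 'f, 'i \<Rightarrow> 'f) persistence) t)) (\<beta> t)"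
  let ?h = "\<lambda>y. ?g (\<phi> t (\<alpha> t y)) i"
  have lin: "linear_map class_ring ?W (fib A t) (\<alpha> t)" "linear_map class_ring (fib A t) (fib B t) (\<phi> t)"
    and iso: "pm_iso (interval_sum I a c) B \<beta>"
    using rep by (auto simp: represents_def pm_iso_def pm_morphism_def)
  have add: "?h (y \<oplus>\<^bsub>?W\<^esub> z) = ?h y + ?h z" if "y \<in> carrier ?W" "z \<in> carrier ?W" for y z
    using lin that pm_iso_inverse_add[OF iso, of "\<phi> t (\<alpha> t y)" t "\<phi> t (\<alpha> t z)"] i
    by (simp add: linear_map_iff interval_sum_simps)
  have zero: "\<zero>\<^bsub>?W\<^esub> \<in> carrier ?W" "\<zero>\<^bsub>?W\<^esub> \<oplus>\<^bsub>?W\<^esub> \<zero>\<^bsub>?W\<^esub> = \<zero>\<^bsub>?W\<^esub>"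
    using \<open>finite J\<close> by (auto simp: interval_sum_carrier interval_sum_simps cong: restrict_cong)
  \<comment> \<open>The value at zero follows from additivity alone, since it equals its own
    double.\<close>
  have h0: "?h (\<lambda>k\<in>J. 0) = 0"
  proof -
    have "?h \<zero>\<^bsub>?W\<^esub> = ?h \<zero>\<^bsub>?W\<^esub> + ?h \<zero>\<^bsub>?W\<^esub>"
      using add[OF zero(1) zero(1)] unfolding zero(2) .
    then have "?h \<zero>\<^bsub>?W\<^esub> = 0" by (simp only: add_cancel_right_right)
    then show ?thesis by (simp add: interval_sum_simps)
  qed
  have partial: "?h (\<lambda>k\<in>J. if k \<in> S then x k else 0) = (\<Sum>j\<in>S. X i j * x j)" if "S \<subseteq> J" for S
    using finite_subset[OF that \<open>finite J\<close>] that
  proof (induction S)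
    case empty
    have "(\<lambda>k\<in>J. if k \<in> {} then x k else 0) = (\<lambda>k\<in>J. 0)" by simp
    then show ?case using h0 by (simp only: sum.empty)
  next
    case (insert j S)
    let ?y = "\<lambda>k\<in>J. if k \<in> S then x k else 0" and ?z = "\<lambda>k\<in>J. if k = j then x j else 0"
    have yz: "?y \<in> carrier ?W" "?z \<in> carrier ?W"
      using x \<open>finite J\<close> by (auto simp: interval_sum_carrier)
    have "(\<lambda>k\<in>J. if k \<in> insert j S then x k else 0) = ?y \<oplus>\<^bsub>?W\<^esub> ?z"
      using insert by (auto simp: interval_sum_simps fun_eq_iff)
    then have "?h (\<lambda>k\<in>J. if k \<in> insert j S then x k else 0) = ?h ?y + ?h ?z"
      using add[OF yz] by simp
    also have "?h ?z = X i j * x j"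
    proof (cases "t \<in> cut_interval (a' j) (c' j)")
      case True
      then show ?thesis using rep i insert.prems by (auto simp: represents_def)
    next
      case False
      then have "x j = 0" using x insert.prems \<open>finite J\<close> by (auto simp: interval_sum_carrier)
      then have "?z = (\<lambda>k\<in>J. 0)" by auto
      then show ?thesis using h0 \<open>x j = 0\<close> by simp
    qed
    finally show ?case using insert by simp
  qed
  have "(\<lambda>k\<in>J. if k \<in> J then x k else 0) = x"
    using x \<open>finite J\<close> by (auto simp: interval_sum_carrier extensional_def)
  then show ?thesis using partial[OF order_refl] by (simp only:)
qed

text \<open>As \<open>\<beta> t\<close> is injective, the image is zero iff its coordinates are.
  Coordinates at bars missing \<open>t\<close> vanish by membership in the carrier, so only rows
  alive at \<open>t\<close> give equations.\<close>

lemma represents_kernel: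
  fixes \<beta> :: "'r::linorder \<Rightarrow> ('i \<Rightarrow> 'f::field) \<Rightarrow> 'b" and x :: "'j \<Rightarrow> 'f"
  assumes "finite J" "finite I"
    and rep: "represents J a' c' A \<alpha> I a c B \<beta> X \<phi>"
    and x: "x \<in> carrier (fib (interval_sum J a' c') t)"
  shows "\<phi> t (\<alpha> t x) = \<zero>\<^bsub>fib B t\<^esub> \<longleftrightarrow>
    (\<forall>i\<in>I. t \<in> cut_interval (a i) (c i) \<longrightarrow> (\<Sum>j\<in>J. X i j * x j) = 0)"
proof -
  let ?W = "fib (interval_sum I a c :: ('r, 'f, 'i \<Rightarrow> 'f) persistence) t"
  let ?y = "the_inv_into (carrier ?W) (\<beta> t) (\<phi> t (\<alpha> t x))"
  have iso: "pm_iso (interval_sum I a c) B \<beta>" and lin: "linear_map class_ring ?W (fib B t) (\<beta> t)"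
    and mem: "\<phi> t (\<alpha> t x) \<in> carrier (fib B t)"
    using rep x by (auto simp: represents_def pm_iso_def pm_morphism_def linear_map_iff)
  have y: "?y \<in> carrier ?W" "\<beta> t ?y = \<phi> t (\<alpha> t x)"
    using pm_iso_inverse[OF iso mem] by auto
  have zero: "\<zero>\<^bsub>?W\<^esub> \<in> carrier ?W" "\<beta> t \<zero>\<^bsub>?W\<^esub> = \<zero>\<^bsub>fib B t\<^esub>"
    using \<open>finite I\<close> linear_map_zero[OF lin] by (auto simp: interval_sum_carrier interval_sum_simps)
  have "inj_on (\<beta> t) (carrier ?W)" using iso by (simp add: pm_iso_def bij_betw_def)
  then have "\<phi> t (\<alpha> t x) = \<zero>\<^bsub>fib B t\<^esub> \<longleftrightarrow> ?y = \<zero>\<^bsub>?W\<^esub>"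
    using y zero by (metis inj_onD)
  also have "\<dots> \<longleftrightarrow> (\<forall>i\<in>I. t \<in> cut_interval (a i) (c i) \<longrightarrow> ?y i = 0)"
    using y(1) \<open>finite I\<close> by (auto simp: interval_sum_carrier interval_sum_simps extensional_def fun_eq_iff)
  also have "\<dots> \<longleftrightarrow> (\<forall>i\<in>I. t \<in> cut_interval (a i) (c i) \<longrightarrow> (\<Sum>j\<in>J. X i j * x j) = 0)"
    using represents_coordinates[OF assms] by simp
  finally show ?thesis .
qed

section \<open>Kernels, and morphisms given by a matrix\<close>

lemma pm_morphism_compose:
  assumes "pm_morphism A B \<phi>" "pm_morphism B C \<psi>"
  shows "pm_morphism A C (\<lambda>t x. \<psi> t (\<phi> t x))"
  using assms unfolding pm_morphism_def by (auto intro: linear_map_compose simp: linear_map_iff)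

text \<open>The restricted carrier is \<open>mod_hom.ker\<close>, which is a submodule.\<close>

lemma vectorspace_pm_kernel:
  assumes "pm_morphism A B \<phi>"
  shows "vectorspace class_ring (fib (pm_kernel A B \<phi>) t)"
proof -
  have lin: "linear_map class_ring (fib A t) (fib B t) (\<phi> t)"
    using assms by (simp add: pm_morphism_def)
  have "mod_hom.ker (fib A t) (fib B t) (\<phi> t) = {x \<in> carrier (fib A t). \<phi> t x = \<zero>\<^bsub>fib B t\<^esub>}"
    using lin mod_hom.ker_def unfolding linear_map_def by blast
  then have "module class_ring (fib (pm_kernel A B \<phi>) t)"
    using lin LinearCombinations.module.submodule_is_module mod_hom.ker_is_submodule
    unfolding linear_map_def vectorspace_def pm_kernel_def by fastforce
  then show ?thesis by (simp add: vectorspace_def class_field)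
qed

lemma pm_morphism_into_kernel:
  assumes "pm_morphism A B \<gamma>" "pm_morphism B C \<phi>"
    "\<And>t x. x \<in> carrier (fib A t) \<Longrightarrow> \<phi> t (\<gamma> t x) = \<zero>\<^bsub>fib C t\<^esub>"
  shows "pm_morphism A (pm_kernel B C \<phi>) \<gamma>"
  using assms vectorspace_pm_kernel[OF assms(2)]
  by (auto simp: pm_morphism_def linear_map_iff pm_kernel_def)

lemma pm_morphism_kernel_inclusion:
  assumes "pm_morphism A B \<phi>"
  shows "pm_morphism (pm_kernel A B \<phi>) A (\<lambda>t x. x)"
  using assms vectorspace_pm_kernel[OF assms]
  by (auto simp: pm_morphism_def linear_map_iff pm_kernel_def)

text \<open>Rows whose bar misses \<open>t\<close> are cut off so that the result lies in the fibre
  at \<open>t\<close>. For the kernel this truncation is the forgetting of dead coordinates.\<close>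

definition matrix_map ::
  "'k set \<Rightarrow> 'j set \<Rightarrow> ('j \<Rightarrow> 'r::linorder cut) \<Rightarrow> ('j \<Rightarrow> 'r cut) \<Rightarrow> ('j \<Rightarrow> 'k \<Rightarrow> 'f::field) \<Rightarrow>
   'r \<Rightarrow> ('k \<Rightarrow> 'f) \<Rightarrow> 'j \<Rightarrow> 'f" where
  "matrix_map K J b d M t f =
     (\<lambda>l\<in>J. if t \<in> cut_interval (b l) (d l) then \<Sum>k\<in>K. M l k * f k else 0)"

lemma pm_morphism_matrix_map:
  fixes M :: "'j \<Rightarrow> 'k \<Rightarrow> 'f::field" and b d :: "'j \<Rightarrow> 'r::linorder cut"
  assumes "finite K" "finite J"
    and tri: "\<And>l k. l \<in> J \<Longrightarrow> k \<in> K \<Longrightarrow> M l k \<noteq> 0 \<Longrightarrow> b l \<le> a k \<and> d l \<le> c k"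
  shows "pm_morphism (interval_sum K a c) (interval_sum J b d) (matrix_map K J b d M)"
  unfolding pm_morphism_def
proof (intro conjI allI impI ballI)
  fix t
  show "linear_map class_ring (fib (interval_sum K a c) t) (fib (interval_sum J b d) t) (matrix_map K J b d M t)"
    using assms(1,2)
    by (auto intro!: vectorspace_interval_sum simp: linear_map_iff interval_sum_carrier interval_sum_simps matrix_map_def fun_eq_iff
        distrib_left sum.distrib sum_distrib_left mult.left_commute)
next
  fix s t :: 'r and f :: "'k \<Rightarrow> 'f" assume st: "s \<le> t" and f: "f \<in> carrier (fib (interval_sum K a c) s)"
  have f0: "f k = 0" if "k \<in> K" "s \<notin> cut_interval (a k) (c k)" for k
    using f that \<open>finite K\<close> by (auto simp: interval_sum_carrier)
  have "(\<Sum>k\<in>K. M l k * str (interval_sum K a c) s t f k) =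
      (if s \<in> cut_interval (b l) (d l) then \<Sum>k\<in>K. M l k * f k else 0)"
    if l: "l \<in> J" "t \<in> cut_interval (b l) (d l)" for l
  proof -
    have "M l k * str (interval_sum K a c) s t f k =
        (if s \<in> cut_interval (b l) (d l) then M l k * f k else 0)" if "k \<in> K" for k
    proof (cases "M l k = 0 \<or> f k = 0")
      case False
      \<comment> \<open>The summand matters only if bar \<open>k\<close> contains \<open>s\<close>,
        while bar \<open>l\<close> contains \<open>t\<close>. Since \<open>l\<close> is born and
        dies no later than \<open>k\<close>, both bars then contain both indices, so the structure
        maps are identities on both sides.\<close>
      then have k: "b l \<le> a k" "d l \<le> c k" "s \<in> cut_interval (a k) (c k)"
        using tri l f0 that by auto
      then have "t \<in> cut_interval (a k) (c k)" "s \<in> cut_interval (b l) (d l)"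
        using l cut_down_closed[OF _ st] by (auto simp: cut_interval_iff less_eq_cut_def)
      then show ?thesis using k that by (simp add: interval_sum_str)
    qed (use that in \<open>auto simp: interval_sum_str\<close>)
    then show ?thesis by simp
  qed
  then show "matrix_map K J b d M t (str (interval_sum K a c) s t f) =
      str (interval_sum J b d) s t (matrix_map K J b d M s f)"
    by (auto simp: matrix_map_def interval_sum_str[of J] fun_eq_iff)
qed

section \<open>The kernel\<close>

theorem theorem9p3:
  fixes U :: "('r::linorder, 'f::field, 'u) persistence"
    and V :: "('r, 'f, 'v) persistence"
    and J :: "'j set" and I :: "'i set"
    and b' d' b'' :: "'j \<Rightarrow> 'r cut"
    and b d :: "'i \<Rightarrow> 'r cut"
    and \<alpha> :: "'r \<Rightarrow> ('j \<Rightarrow> 'f) \<Rightarrow> 'u"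
    and \<beta> :: "'r \<Rightarrow> ('i \<Rightarrow> 'f) \<Rightarrow> 'v"
    and \<phi> :: "'r \<Rightarrow> 'u \<Rightarrow> 'v"
    and X :: "'i \<Rightarrow> 'j \<Rightarrow> 'f"
    and T T_tilde :: "'j \<Rightarrow> 'j \<Rightarrow> 'f"
    and J_list J_cols J_rows :: "'j list" and I_list :: "'i list"
    and P :: "'j set" and p :: "'j \<Rightarrow> 'i" and q :: "'j \<Rightarrow> 'j"
  assumes finite: "finite J" "finite I"
    and modules: "persistence_module U" "persistence_module V"
    and bars: "\<And>j. j \<in> J \<Longrightarrow> b' j \<le> d' j" "\<And>i. i \<in> I \<Longrightarrow> b i \<le> d i"
    and U_sum: "pm_iso (interval_sum J b' d') U \<alpha>"
    and V_sum: "pm_iso (interval_sum I b d) V \<beta>"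
    and morphism: "pm_morphism U V \<phi>"
    and X: "represents J b' d' U \<alpha> I b d V \<beta> X \<phi>"
    and J_order: "distinct J_list" "set J_list = J" "sorted (map b' J_list)"
    and I_order: "distinct I_list" "set I_list = I" "sorted_wrt (\<ge>) (map d I_list)"
    and T: "T = reduction_matrix I_list J_list X"
    and P: "P = {j \<in> J. \<exists>i. pivot_row I_list (column_reduction I_list J_list X) j = Some i
                            \<and> b' j < d i}"
    and p: "\<And>j. j \<in> P \<Longrightarrow>
              p j = the (pivot_row I_list (column_reduction I_list J_list X) j)"
    and b'': "\<And>j. j \<in> J \<Longrightarrow> b'' j = (if j \<in> P then d (p j) else b' j)"
    and J_cols: "distinct J_cols" "set J_cols = J" "sorted (map b'' J_cols)"
    and J_rows: "distinct J_rows" "set J_rows = J" "sorted_wrt (\<ge>) (map d' J_rows)"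
    and T_tilde: "T_tilde = column_reduction J_rows J_cols T"
    and q: "\<And>j. j \<in> J \<Longrightarrow> q j = the (pivot_row J_rows T_tilde j)"
  shows "(\<forall>j\<in>J. b'' j \<le> d' (q j)) \<and>
         (\<exists>\<gamma>. pm_iso (interval_sum J b'' (\<lambda>j. d' (q j))) (pm_kernel U V \<phi>) \<gamma> \<and>
              represents J b'' (\<lambda>j. d' (q j)) (pm_kernel U V \<phi>) \<gamma>
                         J b' d' U \<alpha> T_tilde (\<lambda>t x. x))"
proof -

  \<comment> \<open>Order relations forced by nonzero entries\<close>
  let ?R = "column_reduction I_list J_list X"
  define S where "S = reduction_matrix J_rows J_cols T"
  have sets: "set J_list = J" "set J_cols = J" "set J_rows = J" "set I_list = I"
    using J_order(2) J_cols(2) J_rows(2) I_order(2) by auto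
  have R: "?R = mat_mult J X T" and TS: "T_tilde = mat_mult J T S"
    by (simp_all add: column_reduction_def T T_tilde S_def sets)
  have T_uni: "unitriangular J_list T" and S_uni: "unitriangular J_cols S"
    using unitriangular_reduction_matrix J_order(1) J_cols(1) by (auto simp: T S_def)
  have R_red: "reduced I_list J ?R" and Tt_red: "reduced J_rows J T_tilde"
    using reduced_column_reduction[OF J_order(1)] reduced_column_reduction[OF J_cols(1)]
    by (auto simp: T_tilde sets)
  have X0: "b i \<le> b' j \<and> d i \<le> d' j" if "i \<in> I" "j \<in> J" "X i j \<noteq> 0" for i j
  proof -
    have "b i > b' j \<or> d i > d' j \<longrightarrow> X i j = 0"
      using X that(1,2) by (simp add: represents_def)
    then show ?thesis using that(3) by (auto simp: not_less)
  qed
  have T_le: "b' l \<le> b' m" if "l \<in> J" "m \<in> J" "T l m \<noteq> 0" for l m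
    using reduction_matrix_mono[OF J_order(1,3)] that by (auto simp: T sets)
  have S_le: "b'' l \<le> b'' m" if "l \<in> J" "m \<in> J" "S l m \<noteq> 0" for l m
    using reduction_matrix_mono[OF J_cols(1,3)] that by (auto simp: S_def sets)
  \<comment> \<open>So \<open>b'' j\<close> is the maximum of \<open>b' j\<close> and the death time
    of the pivot row, if there is one. A trivial pivot has \<open>d i \<le> b' j\<close> and does
    not change the maximum, so the case distinction on \<open>P\<close> disappears from here
    on.\<close>
  have b''_iff: "t \<notin> cut_down (b'' j) \<longleftrightarrow>
      t \<notin> cut_down (b' j) \<and> (\<forall>i. pivot_row I_list ?R j = Some i \<longrightarrow> t \<notin> cut_down (d i))"
    if "j \<in> J" for j t
  proof (cases "pivot_row I_list ?R j")
    case None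
    then show ?thesis using b''[OF that] P by auto
  next
    case (Some i)
    have "b' j < d i" if "j \<in> P" using that P Some by auto
    moreover have "d i \<le> b' j" if "j \<notin> P" using that P Some \<open>j \<in> J\<close> by (auto simp: not_less)
    ultimately show ?thesis using Some b''[OF that] p[of j]
      by (cases "j \<in> P") (auto simp: less_eq_cut_def less_cut_def)
  qed
  have b'_le: "b' j \<le> b'' j" if "j \<in> J" for j
    using b''_iff[OF that] by (auto simp: less_eq_cut_def)
  \<comment> \<open>Through an intermediate column \<open>k\<close> of \<open>T\<close>:
    \<open>b' l \<le> b' k \<le> b'' k \<le> b'' j\<close>.\<close>
  have Tt_le: "b' l \<le> b'' j" if lj: "l \<in> J" "j \<in> J" "T_tilde l j \<noteq> 0" for l j
  proof -
    obtain k where "k \<in> J" "T l k \<noteq> 0" "S k j \<noteq> 0"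
      using lj(3) sum_mult_nonzero[of "T l" "\<lambda>k. S k j" J] by (auto simp: TS mat_mult_def)
    then show ?thesis using T_le[of l k] S_le[of k j] b'_le[of k] lj by auto
  qed
  \<comment> \<open>If column \<open>j\<close> of \<open>T_tilde\<close> were zero, \<open>T\<close>
    would annihilate column \<open>j\<close> of \<open>S\<close>, contradicting injectivity of
    \<open>T\<close> and \<open>S j j = 1\<close>.\<close>
  have q_piv: "pivot_row J_rows T_tilde j = Some (q j)" if "j \<in> J" for j
  proof (cases "pivot_row J_rows T_tilde j")
    case None
    then have "(\<Sum>k\<in>J. T l k * S k j) = 0" if "l \<in> J" for l
      using that by (simp add: pivot_row_None_iff sets TS mat_mult_def)
    then have "S j j = 0"
      using unitriangular_injective[OF T_uni, of "\<lambda>k. S k j" j] \<open>j \<in> J\<close> by (simp add: sets)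
    then show ?thesis using S_uni \<open>j \<in> J\<close> by (simp add: unitriangular_def sets)
  qed (use q that in simp)
  have Tt_le_q: "d' l \<le> d' (q j)" if "l \<in> J" "j \<in> J" "T_tilde l j \<noteq> 0" for l j
    using pivot_row_maximal[OF q_piv J_rows(3)] that by (simp add: sets)

  \<comment> \<open>Spanning half of the basis claim for \<open>K\<close>: expand \<open>x\<close>
    in the columns of \<open>T\<close>, discard those that the equations exclude, then pass from
    \<open>T\<close> to \<open>T_tilde\<close> through \<open>S\<close>.\<close>
  have solve: "\<exists>z. (\<forall>j\<in>J. z j \<noteq> 0 \<longrightarrow> t \<notin> cut_down (b'' j)) \<and> (\<forall>l\<in>J. x l = (\<Sum>j\<in>J. T_tilde l j * z j))"
    if supp: "\<And>l. l \<in> J \<Longrightarrow> x l \<noteq> 0 \<Longrightarrow> t \<notin> cut_down (b' l)"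
      and ker: "\<And>i. i \<in> I \<Longrightarrow> t \<in> cut_down (d i) \<Longrightarrow> (\<Sum>l\<in>J. X i l * x l) = 0" for x t
  proof -
    obtain y where y: "\<And>k. k \<in> J \<Longrightarrow> y k \<noteq> 0 \<Longrightarrow> t \<notin> cut_down (b' k)"
      "\<And>l. l \<in> J \<Longrightarrow> x l = (\<Sum>k\<in>J. T l k * y k)"
      using unitriangular_solve[OF T_uni, of "\<lambda>l. t \<notin> cut_down (b' l)" x] T_le supp
      unfolding sets less_eq_cut_def by blast
    have "(\<Sum>k\<in>J. ?R i k * y k) = 0" if "i \<in> I" "t \<in> cut_down (d i)" for i
      using ker[OF that] by (simp add: R mat_mult_vec y(2))
    moreover have "sorted_wrt (\<lambda>i i'. t \<in> cut_down (d i') \<longrightarrow> t \<in> cut_down (d i)) I_list"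
      using I_order(3) unfolding sorted_wrt_map
      by (rule sorted_wrt_mono_rel[rotated]) (auto simp: less_eq_cut_def)
    \<comment> \<open>The rows with \<open>d i > t\<close> come first in \<open>I_list\<close>, so
      distinct pivots kill every coefficient whose pivot lies among them. The remaining columns have
      \<open>b'' \<le> t\<close>.\<close>
    ultimately have "y k = 0" if "k \<in> J" "pivot_row I_list ?R k = Some i" "t \<in> cut_down (d i)" for k i
      using reduced_coefficient_zero[OF R_red finite(1), of "\<lambda>i. t \<in> cut_down (d i)" y k i] that
      by (auto simp: sets)
    then have y'': "t \<notin> cut_down (b'' k)" if "k \<in> J" "y k \<noteq> 0" for k
      using that y(1) b''_iff by blast
    obtain z where z: "\<And>j. j \<in> J \<Longrightarrow> z j \<noteq> 0 \<Longrightarrow> t \<notin> cut_down (b'' j)"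
      "\<And>k. k \<in> J \<Longrightarrow> y k = (\<Sum>j\<in>J. S k j * z j)"
      using unitriangular_solve[OF S_uni, of "\<lambda>l. t \<notin> cut_down (b'' l)" y] S_le y''
      unfolding sets less_eq_cut_def by blast
    then show ?thesis by (intro exI[of _ z]) (auto simp: y(2) TS mat_mult_vec)
  qed

  \<comment> \<open>Converse half: a column \<open>k\<close> that is used has
    \<open>b'' k \<le> t\<close>, so its pivot row has \<open>d \<le> t\<close>. No row with larger
    \<open>d\<close> is nonzero in that column, hence row \<open>i\<close> vanishes
    termwise.\<close>
  have in_ker: "(\<Sum>l\<in>J. X i l * (\<Sum>j\<in>J. T_tilde l j * z j)) = 0"
    if z: "\<And>j. j \<in> J \<Longrightarrow> z j \<noteq> 0 \<Longrightarrow> t \<notin> cut_down (b'' j)"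
      and i: "i \<in> I" "t \<in> cut_down (d i)" for z t i
  proof -
    let ?y = "\<lambda>k. \<Sum>j\<in>J. S k j * z j"
    have "?R i k * ?y k = 0" if k: "k \<in> J" for k
    proof (rule ccontr)
      assume *: "?R i k * ?y k \<noteq> 0"
      then obtain j where "j \<in> J" "S k j \<noteq> 0" "z j \<noteq> 0"
        using sum_mult_nonzero[of "S k" z J] by auto
      then have "t \<notin> cut_down (b'' k)" using S_le[of k j] z[of j] k by (auto simp: less_eq_cut_def)
      moreover obtain i' where "pivot_row I_list ?R k = Some i'"
        using * i by (cases "pivot_row I_list ?R k") (auto simp: pivot_row_None_iff sets)
      ultimately show False
        using pivot_row_maximal[of I_list ?R k i' d i] I_order(3) i * b''_iff[OF k]
        by (auto simp: sets less_eq_cut_def)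
    qed
    then have "(\<Sum>k\<in>J. ?R i k * ?y k) = 0" by simp
    then show ?thesis by (simp add: R TS mat_mult_vec)
  qed

  \<comment> \<open>At an index \<open>t\<close> with \<open>d' (q j) \<le> t < b'' j\<close>, column \<open>j\<close> of \<open>T_tilde\<close> would lie in the space
    \<open>K\<close> of the introduction, and so be a combination of other columns.\<close>
  have le_q: "b'' j \<le> d' (q j)" if j: "j \<in> J" for j
  proof (rule ccontr)
    assume "\<not> b'' j \<le> d' (q j)"
    then obtain t where t: "t \<in> cut_down (b'' j)" "t \<notin> cut_down (d' (q j))"
      by (auto simp: less_eq_cut_def)
    \<comment> \<open>The pivot has the largest \<open>d'\<close> among the nonzero rows, so the
      whole column lives in rows dead at \<open>t\<close>. There \<open>X\<close> has no entries in
      rows with \<open>d i > t\<close>, and \<open>b' l \<le> d' l\<close> gives the support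
      condition for \<open>solve\<close>.\<close>
    have td: "t \<notin> cut_down (d' l)" if "l \<in> J" "T_tilde l j \<noteq> 0" for l
      using Tt_le_q[of l j] that j t by (auto simp: less_eq_cut_def)
    have "X i l * T_tilde l j = 0" if "i \<in> I" "t \<in> cut_down (d i)" "l \<in> J" for i l
      using td[of l] X0[of i l] that by (auto simp: less_eq_cut_def)
    then have ker: "(\<Sum>l\<in>J. X i l * T_tilde l j) = 0" if "i \<in> I" "t \<in> cut_down (d i)" for i
      using that by simp
    have supp: "t \<notin> cut_down (b' l)" if "l \<in> J" "T_tilde l j \<noteq> 0" for l
      using td[OF that] bars(1)[OF that(1)] by (auto simp: less_eq_cut_def)
    obtain z where z: "\<And>j. j \<in> J \<Longrightarrow> z j \<noteq> 0 \<Longrightarrow> t \<notin> cut_down (b'' j)"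
      "\<And>l. l \<in> J \<Longrightarrow> T_tilde l j = (\<Sum>m\<in>J. T_tilde l m * z m)"
      using solve[of "\<lambda>l. T_tilde l j" t, OF supp ker] by blast
    \<comment> \<open>A linear relation among the columns of \<open>T_tilde\<close>. As
      \<open>b'' j > t\<close>, \<open>z j = 0\<close> and the coefficient at \<open>j\<close> is
      -1, whereas distinct pivots force it to be 0.\<close>
    let ?w = "\<lambda>m. z m - (if m = j then 1 else 0)"
    have "(\<Sum>m\<in>J. T_tilde l m * ?w m) = 0" if "l \<in> J" for l
      using z(2)[OF that] finite(1) j by (simp add: right_diff_distrib sum_subtractf sum_two_delta)
    then have "?w j = 0"
      using reduced_coefficient_zero[OF Tt_red finite(1), of "\<lambda>_. True" ?w j "q j"] j q_piv[OF j]
      by (simp add: sets sorted_wrt_true)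
    then show False using z(1)[OF j] t by simp
  qed

  \<comment> \<open>The isomorphism onto the kernel\<close>
  let ?A = "interval_sum J b'' (\<lambda>j. d' (q j)) :: ('r, 'f, 'j \<Rightarrow> 'f) persistence"
  let ?B = "interval_sum J b' d' :: ('r, 'f, 'j \<Rightarrow> 'f) persistence"
  let ?m = "matrix_map J J b' d' T_tilde"
  define \<gamma> where "\<gamma> = (\<lambda>t f. \<alpha> t (?m t f))"
  have m: "pm_morphism ?A ?B ?m"
    using pm_morphism_matrix_map[of J J T_tilde b' b'' d' "\<lambda>j. d' (q j)"] Tt_le Tt_le_q finite(1) by blast
  have m_carrier: "?m t f \<in> carrier (fib ?B t)" if "f \<in> carrier (fib ?A t)" for t f
    using m that by (simp add: pm_morphism_def linear_map_iff)
  have \<alpha>: "pm_morphism ?B U \<alpha>" "inj_on (\<alpha> t) (carrier (fib ?B t))" for t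
    using U_sum by (auto simp: pm_iso_def bij_betw_def)
  have m_ker: "\<phi> t (\<gamma> t f) = \<zero>\<^bsub>fib V t\<^esub>" if f: "f \<in> carrier (fib ?A t)" for t f
  proof -
    have f0: "t \<in> cut_interval (b'' j) (d' (q j))" if "j \<in> J" "f j \<noteq> 0" for j
      using f that finite(1) by (auto simp: interval_sum_carrier)
    have "(\<Sum>l\<in>J. X i l * ?m t f l) = 0" if i: "i \<in> I" "t \<in> cut_interval (b i) (d i)" for i
    proof -
      \<comment> \<open>Truncation is invisible to \<open>X\<close> here. In a row \<open>l\<close>
        with \<open>b' l > t\<close> the full sum is zero too, and for \<open>d' l \<le> t\<close>
        the entry \<open>X i l\<close> is zero because \<open>t\<close> lies below
        \<open>d i\<close>.\<close>
      have "X i l * ?m t f l = X i l * (\<Sum>j\<in>J. T_tilde l j * f j)" if l: "l \<in> J" for l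
      proof (cases "t \<in> cut_down (b' l)")
        case True
        then have "T_tilde l j * f j = 0" if "j \<in> J" for j
          using f0[OF that] Tt_le[OF l that] by (auto simp: cut_interval_iff less_eq_cut_def)
        then show ?thesis by (simp add: matrix_map_def l)
      next
        case False
        then show ?thesis using X0[OF i(1) l] i(2) l
          by (auto simp: matrix_map_def cut_interval_iff less_eq_cut_def)
      qed
      then have "(\<Sum>l\<in>J. X i l * ?m t f l) = (\<Sum>l\<in>J. X i l * (\<Sum>j\<in>J. T_tilde l j * f j))"
        by (rule sum.cong[OF refl])
      also have "\<dots> = 0" using in_ker[of f t i] f0 i by (auto simp: cut_interval_iff)
      finally show ?thesis .
    qed
    then show ?thesis using represents_kernel[OF finite X m_carrier[OF f]] by (simp add: \<gamma>_def)
  qed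
  have \<gamma>_mor: "pm_morphism ?A (pm_kernel U V \<phi>) \<gamma>"
    using pm_morphism_into_kernel[OF _ morphism, of ?A \<gamma>] pm_morphism_compose[OF m \<alpha>(1)] m_ker
    by (simp add: \<gamma>_def)
  have inj: "inj_on (\<gamma> t) (carrier (fib ?A t))" for t
  proof (rule inj_onI)
    fix f g assume f: "f \<in> carrier (fib ?A t)" and g: "g \<in> carrier (fib ?A t)" and "\<gamma> t f = \<gamma> t g"
    then have fg: "?m t f = ?m t g"
      using \<alpha>(2) m_carrier unfolding \<gamma>_def by (metis inj_onD)
    have 0: "f j = 0 \<and> g j = 0" if "j \<in> J" "t \<notin> cut_interval (b'' j) (d' (q j))" for j
      using f g that finite(1) by (auto simp: interval_sum_carrier)
    let ?w = "\<lambda>j. f j - g j"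
    \<comment> \<open>Rows alive at \<open>t\<close> are compared by \<open>fg\<close>, and rows not
      yet born vanish termwise. Hence coefficients with \<open>d' (q j) > t\<close> agree by
      distinct pivots; the others are 0 in both vectors because their bars miss
      \<open>t\<close>.\<close>
    have "(\<Sum>j\<in>J. T_tilde l j * ?w j) = 0" if l: "l \<in> J" "t \<in> cut_down (d' l)" for l
    proof (cases "t \<in> cut_down (b' l)")
      case True
      then have "T_tilde l j * ?w j = 0" if "j \<in> J" for j
        using 0[OF that] Tt_le[OF l(1) that] True
        by (cases "f j = 0 \<and> g j = 0") (auto simp: cut_interval_iff less_eq_cut_def)
      then show ?thesis by simp
    next
      case False
      then show ?thesis using fun_cong[OF fg, of l] l
        by (simp add: matrix_map_def cut_interval_iff right_diff_distrib sum_subtractf)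
    qed
    moreover have "sorted_wrt (\<lambda>l l'. t \<in> cut_down (d' l') \<longrightarrow> t \<in> cut_down (d' l)) J_rows"
      using J_rows(3) unfolding sorted_wrt_map
      by (rule sorted_wrt_mono_rel[rotated]) (auto simp: less_eq_cut_def)
    ultimately have w: "?w j = 0" if "j \<in> J" "t \<in> cut_down (d' (q j))" for j
      using reduced_coefficient_zero[OF Tt_red finite(1), of "\<lambda>l. t \<in> cut_down (d' l)" ?w j "q j"]
        that q_piv by (auto simp: sets)
    show "f = g"
    proof (rule extensionalityI)
      show "f \<in> extensional J" "g \<in> extensional J" using f g finite(1) by (auto simp: interval_sum_carrier)
      show "f j = g j" if "j \<in> J" for j
        using w[OF that] 0[OF that] by (cases "t \<in> cut_down (d' (q j))") (auto simp: cut_interval_iff)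
    qed
  qed
  have surj: "u \<in> \<gamma> t ` carrier (fib ?A t)" if u: "u \<in> carrier (fib (pm_kernel U V \<phi>) t)" for u t
  proof -
    define x where "x = the_inv_into (carrier (fib ?B t)) (\<alpha> t) u"
    have x: "x \<in> carrier (fib ?B t)" "\<alpha> t x = u" and u0: "\<phi> t u = \<zero>\<^bsub>fib V t\<^esub>"
      using pm_iso_inverse[OF U_sum, of u t] u by (auto simp: x_def pm_kernel_def)
    have x0: "t \<in> cut_interval (b' l) (d' l)" if "l \<in> J" "x l \<noteq> 0" for l
      using x(1) that finite(1) by (auto simp: interval_sum_carrier)
    \<comment> \<open>\<open>solve\<close> also asks about rows not yet born at \<open>t\<close>.
      There a nonzero \<open>X i l\<close> gives \<open>b i \<le> b' l\<close>, so bar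
      \<open>l\<close> is not born either and \<open>x l = 0\<close>.\<close>
    have ker: "(\<Sum>l\<in>J. X i l * x l) = 0" if i: "i \<in> I" "t \<in> cut_down (d i)" for i
    proof (cases "t \<in> cut_down (b i)")
      case True
      then have "X i l * x l = 0" if "l \<in> J" for l
        using x0[OF that] X0[OF i(1) that] by (auto simp: cut_interval_iff less_eq_cut_def)
      then show ?thesis by simp
    next
      case False
      then show ?thesis using represents_kernel[OF finite X x(1)] x(2) u0 i
        by (simp add: cut_interval_iff)
    qed
    have supp: "t \<notin> cut_down (b' l)" if "l \<in> J" "x l \<noteq> 0" for l
      using x0[OF that] by (simp add: cut_interval_iff)
    obtain z where z: "\<And>j. j \<in> J \<Longrightarrow> z j \<noteq> 0 \<Longrightarrow> t \<notin> cut_down (b'' j)"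
      "\<And>l. l \<in> J \<Longrightarrow> x l = (\<Sum>j\<in>J. T_tilde l j * z j)"
      using solve[of x t, OF supp ker] by blast
    \<comment> \<open>Coefficients with \<open>d' (q j) \<le> t\<close> are dropped. Their columns
      have nonzero entries only in rows with \<open>d' \<le> t\<close>, so no coordinate alive at
      \<open>t\<close> changes.\<close>
    define f where "f = (\<lambda>j\<in>J. if t \<in> cut_interval (b'' j) (d' (q j)) then z j else 0)"
    have f: "f \<in> carrier (fib ?A t)" using finite(1) by (auto simp: f_def interval_sum_carrier)
    have "?m t f l = x l" if l: "l \<in> J" for l
    proof (cases "t \<in> cut_interval (b' l) (d' l)")
      case True
      have "T_tilde l j * f j = T_tilde l j * z j" if "j \<in> J" for j
        using z(1)[OF that] Tt_le_q[OF l that] True that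
        by (auto simp: f_def cut_interval_iff less_eq_cut_def)
      then have "(\<Sum>j\<in>J. T_tilde l j * f j) = (\<Sum>j\<in>J. T_tilde l j * z j)"
        by (rule sum.cong[OF refl])
      then show ?thesis using True l z(2)[OF l] by (simp add: matrix_map_def)
    qed (use x0 l in \<open>auto simp: matrix_map_def\<close>)
    moreover have "x \<in> extensional J" "?m t f \<in> extensional J"
      using x(1) finite(1) by (auto simp: interval_sum_carrier matrix_map_def)
    ultimately have "?m t f = x" by (auto intro: extensionalityI)
    then show ?thesis using f x(2) by (auto simp: \<gamma>_def)
  qed
  have \<gamma>: "pm_iso ?A (pm_kernel U V \<phi>) \<gamma>"
    unfolding pm_iso_def bij_betw_def
    using \<gamma>_mor inj surj by (auto simp: pm_morphism_def linear_map_iff)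
  \<comment> \<open>Since \<open>\<gamma>\<close> is \<open>\<alpha>\<close> after
    \<open>?m\<close>, undoing \<open>\<alpha>\<close> leaves the matrix map itself, whose value on
    a unit vector is a column of \<open>T_tilde\<close>.\<close>
  have entry: "the_inv_into (carrier (fib ?B t)) (\<alpha> t) (\<gamma> t (\<lambda>k\<in>J. if k = j then x else 0)) i = T_tilde i j * x"
    if "i \<in> J" "j \<in> J" "t \<in> cut_interval (b' i) (d' i) \<inter> cut_interval (b'' j) (d' (q j))" for i j t x
  proof -
    let ?e = "\<lambda>k\<in>J. if k = j then x else 0"
    have "?e \<in> carrier (fib ?A t)"
      using that finite(1) by (auto simp: interval_sum_carrier)
    then have "the_inv_into (carrier (fib ?B t)) (\<alpha> t) (\<gamma> t ?e) = ?m t ?e"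
      using the_inv_into_f_f[OF \<alpha>(2) m_carrier] by (simp add: \<gamma>_def)
    moreover have "(\<Sum>k\<in>J. T_tilde i k * ?e k) = T_tilde i j * x"
      using sum_two_delta[OF finite(1) that(2)] by (simp cong: sum.cong)
    ultimately show ?thesis using that by (simp add: matrix_map_def)
  qed
  have zero: "T_tilde i j = 0" if "i \<in> J" "j \<in> J" "b' i > b'' j \<or> d' i > d' (q j)" for i j
    using Tt_le[OF that(1,2)] Tt_le_q[OF that(1,2)] that(3) by (metis leD)
  have "represents J b'' (\<lambda>j. d' (q j)) (pm_kernel U V \<phi>) \<gamma> J b' d' U \<alpha> T_tilde (\<lambda>t x. x)"
    unfolding represents_def
  proof (intro conjI ballI allI impI)
    show "pm_iso ?A (pm_kernel U V \<phi>) \<gamma>" "pm_iso ?B U \<alpha>" by (fact \<gamma> U_sum)+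
    show "pm_morphism (pm_kernel U V \<phi>) U (\<lambda>t x. x)"
      by (rule pm_morphism_kernel_inclusion[OF morphism])
  qed (fact zero entry)+
  with le_q \<gamma> show ?thesis by (intro conjI ballI exI[of _ \<gamma>])
qed

end
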